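(* Let $G$ be a locally compact group and let $\pi$ be a continuous unitary representation of $G$. Then the Šilov boundary of the uniform algebra $\mathcal{A}(\pi)$ is $$\partial_{\mathcal{A}(\pi)}=G^{\mathcal{A}(\pi)}\setminus\{0\}.$$
   Context: A continuous unitary representation $\pi:G\to\mathcal{U}(\mathcal{H}_\pi)$ is one for which every matrix coefficient $s\mapsto\langle\pi(s)\xi|\eta\rangle$ is continuous. Let $F_\pi=\mathrm{span}\{\langle\pi(\cdot)\xi|\eta\rangle:\xi,\eta\in\mathcal{H}_\pi\}$, a space of bounded continuous functions on $G$. Let $\mathrm{alg}(F_\pi)$ be the (not necessarily unital) algebra of functions generated by $F_\pi$ under pointwise operations, and let $\mathcal{A}(\pi)$ be the closure of $\mathrm{alg}(F_\pi)$ in the uniform norm, a closed subalgebra of the C*-algebra $\mathcal{CB}(G)$ of continuous bounded functions on $G$. $\Phi_{\mathcal{A}(\pi)}$ is the Gelfand spectrum (non-zero characters) of $\mathcal{A}(\pi)$ with the weak* topology. $\varepsilon:G\to\mathcal{A}(\pi)^*$ is the evaluation map, $\varepsilon(s)(f)=f(s)$, and $G^{\mathcal{A}(\pi)}=\overline{\varepsilon(G)}^{w^*}\subset\mathcal{A}(\pi)^*$; thus $G^{\mathcal{A}(\pi)}\setminus\{0\}\subset\Phi_{\mathcal{A}(\pi)}$. For a closed subalgebra $\mathcal{A}$ of a commutative C*-algebra, a boundary is a closed subset $B\subset\Phi_{\mathcal{A}}$ such that $f\mapsto\hat f|_B:\mathcal{A}\to\mathcal{C}_0(B)$ is an isometry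 ($\hat f$ is the Gelfand transform); the Šilov boundary $\partial_{\mathcal{A}}$ is the intersection of all boundaries, and is itself a boundary. *)

theory Defs
  imports "HOL-Analysis.Analysis"
begin

section \<open>Complex Hilbert spaces\<close>

text \<open>The inner product is linear in the first argument. Completeness comes from the class
  banach; positive definiteness follows from the last axiom and the norm axioms.\<close>

class complex_hilbert_space = banach +
  fixes scaleC :: "complex \<Rightarrow> 'a \<Rightarrow> 'a"
    and cinner :: "'a \<Rightarrow> 'a \<Rightarrow> complex"
  assumes scaleC_of_real: "scaleC (complex_of_real r) x = r *\<^sub>R x"
    and scaleC_add_right: "scaleC a (x + y) = scaleC a x + scaleC a y"
    and scaleC_add_left: "scaleC (a + b) x = scaleC a x + scaleC b x"
    and scaleC_scaleC: "scaleC a (scaleC b x) = scaleC (a * b) x"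
    and cinner_commute: "cinner x y = cnj (cinner y x)"
    and cinner_add_left: "cinner (x + y) z = cinner x z + cinner y z"
    and cinner_scaleC_left: "cinner (scaleC a x) y = a * cinner x y"
    and cinner_self: "cinner x x = complex_of_real ((norm x)\<^sup>2)"

instantiation complex :: complex_hilbert_space
begin

definition scaleC_complex :: "complex \<Rightarrow> complex \<Rightarrow> complex"
  where "scaleC_complex a x = a * x"

definition cinner_complex :: "complex \<Rightarrow> complex \<Rightarrow> complex"
  where "cinner_complex x y = x * cnj y"

instance
  by standard (simp_all add: scaleC_complex_def cinner_complex_def scaleR_conv_of_real
      algebra_simps flip: complex_norm_square)

end

lemma cinner_add_right:
  "cinner x (y + z) = cinner x y + cinner (x :: 'a::complex_hilbert_space) z"
  by (metis cinner_add_left cinner_commute complex_cnj_add)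

lemma cinner_scaleC_right:
  "cinner x (scaleC a y) = cnj a * cinner (x :: 'a::complex_hilbert_space) y"
  by (metis cinner_commute cinner_scaleC_left complex_cnj_mult)

lemma cmod_cinner_le: "cmod (cinner x y) \<le> norm x * norm (y :: 'a::complex_hilbert_space)"
proof (cases "y = 0")
  case True
  have "cinner x 0 = 0"
    using cinner_add_right[of x 0 0] by simp
  with True show ?thesis by simp
next
  case False
  define n where "n = complex_of_real ((norm y)\<^sup>2)"
  define c where "c = cinner x y"
  define z where "z = scaleC n x + scaleC (- c) y"
  have n: "cinner y y = n" "cnj n = n"
    by (simp_all add: cinner_self n_def)
  have yx: "cinner y x = cnj c"
    by (simp add: c_def cinner_commute[of y x])
  have "cinner z z = n * (n * cinner x x - c * cnj c)"
    by (simp add: z_def cinner_add_left cinner_add_right cinner_scaleC_left cinner_scaleC_right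
        n yx c_def[symmetric] algebra_simps)
  then have "complex_of_real ((norm z)\<^sup>2)
      = complex_of_real ((norm y)\<^sup>2 * ((norm y)\<^sup>2 * (norm x)\<^sup>2 - (cmod c)\<^sup>2))"
    by (simp add: cinner_self n_def flip: complex_norm_square)
  then have "(norm z)\<^sup>2 = (norm y)\<^sup>2 * ((norm y)\<^sup>2 * (norm x)\<^sup>2 - (cmod c)\<^sup>2)"
    using of_real_eq_iff by blast
  then have "0 \<le> (norm y)\<^sup>2 * ((norm y)\<^sup>2 * (norm x)\<^sup>2 - (cmod c)\<^sup>2)"
    by (metis zero_le_power2)
  then have "(cmod c)\<^sup>2 \<le> (norm x * norm y)\<^sup>2"
    using False by (simp add: zero_le_mult_iff power_mult_distrib mult.commute)
  then show ?thesis
    unfolding c_def by (rule power2_le_imp_le) simp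
qed

section \<open>Continuous unitary representations\<close>

definition unitary_op :: "('h::complex_hilbert_space \<Rightarrow> 'h) \<Rightarrow> bool"
  where "unitary_op U \<longleftrightarrow>
    (\<forall>x y. U (x + y) = U x + U y) \<and> (\<forall>c x. U (scaleC c x) = scaleC c (U x)) \<and>
    (\<forall>x y. cinner (U x) (U y) = cinner x y) \<and> surj U"

text \<open>Groups are written additively, as in the library's class of topological groups; they are
  not assumed to be commutative.\<close>

definition continuous_unitary_rep ::
    "('g::topological_group_add \<Rightarrow> 'h::complex_hilbert_space \<Rightarrow> 'h) \<Rightarrow> bool"
  where "continuous_unitary_rep \<pi> \<longleftrightarrow>
    (\<forall>s. unitary_op (\<pi> s)) \<and> (\<forall>s t. \<pi> (s + t) = \<pi> s \<circ> \<pi> t) \<and>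
    (\<forall>\<xi> \<eta>. continuous_on UNIV (\<lambda>s. cinner (\<pi> s \<xi>) \<eta>))"

section \<open>The algebra of bounded continuous functions\<close>

lemma times_bcontfun_closed:
  fixes f g :: "'a::topological_space \<Rightarrow> 'b::real_normed_algebra"
  assumes "f \<in> bcontfun" "g \<in> bcontfun"
  shows "(\<lambda>x. f x * g x) \<in> bcontfun"
proof -
  from assms obtain F G where "f = apply_bcontfun F" "g = apply_bcontfun G"
    by (metis bcontfunE)
  then show ?thesis
    by (intro bcontfun_normI[where b = "norm F * norm G"] continuous_intros)
      (auto intro!: order_trans[OF norm_mult_ineq] mult_mono norm_bounded)
qed

instantiation bcontfun :: (topological_space, real_normed_algebra) real_normed_algebra
begin

definition times_bcontfun :: "('a \<Rightarrow>\<^sub>C 'b) \<Rightarrow> ('a \<Rightarrow>\<^sub>C 'b) \<Rightarrow> ('a \<Rightarrow>\<^sub>C 'b)"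
  where "times_bcontfun f g = Bcontfun (\<lambda>x. apply_bcontfun f x * apply_bcontfun g x)"

lemma apply_times_bcontfun [simp]:
  "apply_bcontfun (f * g) x = apply_bcontfun f x * apply_bcontfun g x"
  for f g :: "'a \<Rightarrow>\<^sub>C 'b"
  by (simp add: times_bcontfun_def Bcontfun_inverse times_bcontfun_closed apply_bcontfun)

instance
proof
  fix f g :: "'a \<Rightarrow>\<^sub>C 'b"
  show "norm (f * g) \<le> norm f * norm g"
    by (rule norm_bound)
      (auto intro!: order_trans[OF norm_mult_ineq] mult_mono norm_bounded)
qed (auto intro!: bcontfun_eqI simp: algebra_simps)

end

text \<open>Multiplication by a complex scalar is multiplication by a constant function.\<close>

abbreviation cscale :: "complex \<Rightarrow> ('a::topological_space \<Rightarrow>\<^sub>C complex) \<Rightarrow> ('a \<Rightarrow>\<^sub>C complex)"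
  where "cscale c f \<equiv> const_bcontfun c * f"

interpretation complex_bcontfun:
  vector_space "cscale :: complex \<Rightarrow> ('a::topological_space \<Rightarrow>\<^sub>C complex) \<Rightarrow> _"
  by standard (auto intro!: bcontfun_eqI simp: algebra_simps)

inductive_set generated_alg ::
    "('a::topological_space \<Rightarrow>\<^sub>C complex) set \<Rightarrow> ('a \<Rightarrow>\<^sub>C complex) set"
  for F :: "('a \<Rightarrow>\<^sub>C complex) set"
  where
    base: "f \<in> F \<Longrightarrow> f \<in> generated_alg F"
  | zero: "0 \<in> generated_alg F"
  | add: "f \<in> generated_alg F \<Longrightarrow> g \<in> generated_alg F \<Longrightarrow> f + g \<in> generated_alg F"
  | scale: "f \<in> generated_alg F \<Longrightarrow> cscale c f \<in> generated_alg F"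
  | mult: "f \<in> generated_alg F \<Longrightarrow> g \<in> generated_alg F \<Longrightarrow> f * g \<in> generated_alg F"

section \<open>The algebra of a representation\<close>

definition matrix_coeff ::
    "('g::topological_group_add \<Rightarrow> 'h::complex_hilbert_space \<Rightarrow> 'h) \<Rightarrow> 'h \<Rightarrow> 'h \<Rightarrow> ('g \<Rightarrow>\<^sub>C complex)"
  where "matrix_coeff \<pi> \<xi> \<eta> = Bcontfun (\<lambda>s. cinner (\<pi> s \<xi>) \<eta>)"

lemma apply_matrix_coeff:
  assumes "continuous_unitary_rep \<pi>"
  shows "apply_bcontfun (matrix_coeff \<pi> \<xi> \<eta>) s = cinner (\<pi> s \<xi>) \<eta>"
proof -
  have "norm (\<pi> s \<xi>) = norm \<xi>" for s
  proof -
    have "cinner (\<pi> s \<xi>) (\<pi> s \<xi>) = cinner \<xi> \<xi>"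
      using assms by (simp add: continuous_unitary_rep_def unitary_op_def)
    then have "(norm (\<pi> s \<xi>))\<^sup>2 = (norm \<xi>)\<^sup>2"
      unfolding cinner_self of_real_eq_iff .
    then show ?thesis by simp
  qed
  then have "cmod (cinner (\<pi> s \<xi>) \<eta>) \<le> norm \<xi> * norm \<eta>" for s
    by (metis cmod_cinner_le)
  with assms have "(\<lambda>s. cinner (\<pi> s \<xi>) \<eta>) \<in> bcontfun"
    by (intro bcontfun_normI) (auto simp: continuous_unitary_rep_def)
  then show ?thesis
    by (simp add: matrix_coeff_def Bcontfun_inverse)
qed

definition coeff_space ::
    "('g::topological_group_add \<Rightarrow> 'h::complex_hilbert_space \<Rightarrow> 'h) \<Rightarrow> ('g \<Rightarrow>\<^sub>C complex) set"
  where "coeff_space \<pi> = complex_bcontfun.span {matrix_coeff \<pi> \<xi> \<eta> | \<xi> \<eta>. True}"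

definition rep_algebra ::
    "('g::topological_group_add \<Rightarrow> 'h::complex_hilbert_space \<Rightarrow> 'h) \<Rightarrow> ('g \<Rightarrow>\<^sub>C complex) set"
  where "rep_algebra \<pi> = closure (generated_alg (coeff_space \<pi>))"

section \<open>Dual space, spectrum and Silov boundary\<close>

text \<open>Throughout, \<open>A\<close> is a closed subalgebra of the bounded continuous functions on a space.
  A functional on \<open>A\<close> is represented by a function that is undefined outside of \<open>A\<close>, so that the
  weak* topology is the topology induced by the product topology over the index set \<open>A\<close>.\<close>

definition dual_space ::
    "('a::topological_space \<Rightarrow>\<^sub>C complex) set \<Rightarrow> (('a \<Rightarrow>\<^sub>C complex) \<Rightarrow> complex) set"
  where "dual_space A = {\<phi> \<in> extensional A.
    (\<forall>f\<in>A. \<forall>g\<in>A. \<phi> (f + g) = \<phi> f + \<phi> g) \<and> (\<forall>c. \<forall>f\<in>A. \<phi> (cscale c f) = c * \<phi> f) \<and>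
    (\<exists>K. \<forall>f\<in>A. cmod (\<phi> f) \<le> K * norm f)}"

definition zero_functional ::
    "('a::topological_space \<Rightarrow>\<^sub>C complex) set \<Rightarrow> ('a \<Rightarrow>\<^sub>C complex) \<Rightarrow> complex"
  where "zero_functional A = (\<lambda>f\<in>A. 0)"

definition weak_star ::
    "('a::topological_space \<Rightarrow>\<^sub>C complex) set \<Rightarrow> (('a \<Rightarrow>\<^sub>C complex) \<Rightarrow> complex) topology"
  where "weak_star A = subtopology (product_topology (\<lambda>_. euclidean) A) (dual_space A)"

text \<open>Characters of a Banach algebra are automatically bounded, so taking them from the dual space
  is no restriction.\<close>

definition gelfand_spectrum ::
    "('a::topological_space \<Rightarrow>\<^sub>C complex) set \<Rightarrow> (('a \<Rightarrow>\<^sub>C complex) \<Rightarrow> complex) set"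
  where "gelfand_spectrum A = {\<phi> \<in> dual_space A.
    (\<forall>f\<in>A. \<forall>g\<in>A. \<phi> (f * g) = \<phi> f * \<phi> g) \<and> \<phi> \<noteq> zero_functional A}"

definition gelfand_transform ::
    "('a::topological_space \<Rightarrow>\<^sub>C complex) \<Rightarrow> (('a \<Rightarrow>\<^sub>C complex) \<Rightarrow> complex) \<Rightarrow> complex"
  where "gelfand_transform f \<phi> = \<phi> f"

definition C0_space :: "'b topology \<Rightarrow> ('b \<Rightarrow> complex) set"
  where "C0_space X = {h. continuous_map X euclidean h \<and>
    (\<forall>e>0. \<exists>K. compactin X K \<and> (\<forall>x \<in> topspace X - K. cmod (h x) < e))}"

text \<open>Inserting 0 gives the right value, 0, on the empty set.\<close>

definition sup_norm_on :: "'b set \<Rightarrow> ('b \<Rightarrow> complex) \<Rightarrow> real"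
  where "sup_norm_on B h = Sup (insert 0 ((\<lambda>x. cmod (h x)) ` B))"

text \<open>The Gelfand transform is linear, so being isometric means preserving the norm.\<close>

definition is_boundary ::
    "('a::topological_space \<Rightarrow>\<^sub>C complex) set \<Rightarrow> (('a \<Rightarrow>\<^sub>C complex) \<Rightarrow> complex) set \<Rightarrow> bool"
  where "is_boundary A B \<longleftrightarrow>
    closedin (subtopology (weak_star A) (gelfand_spectrum A)) B \<and>
    (\<forall>f\<in>A. gelfand_transform f \<in> C0_space (subtopology (weak_star A) B) \<and>
           sup_norm_on B (gelfand_transform f) = norm f)"

definition silov_boundary ::
    "('a::topological_space \<Rightarrow>\<^sub>C complex) set \<Rightarrow> (('a \<Rightarrow>\<^sub>C complex) \<Rightarrow> complex) set"
  where "silov_boundary A = \<Inter> {B. is_boundary A B}"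

definition evaluation ::
    "('a::topological_space \<Rightarrow>\<^sub>C complex) set \<Rightarrow> 'a \<Rightarrow> ('a \<Rightarrow>\<^sub>C complex) \<Rightarrow> complex"
  where "evaluation A s = (\<lambda>f\<in>A. apply_bcontfun f s)"

definition evaluation_closure ::
    "('a::topological_space \<Rightarrow>\<^sub>C complex) set \<Rightarrow> (('a \<Rightarrow>\<^sub>C complex) \<Rightarrow> complex) set"
  where "evaluation_closure A = weak_star A closure_of range (evaluation A)"

end

theory Submission
  imports Defs
begin

text \<open>The nonzero part of the weak* closure of the evaluations is a boundary because it is locally
  compact by Alaoglu's theorem and already contains enough points to compute norms. Conversely,
  every evaluation lies in every boundary \<open>B\<close>: for a unit vector \<open>\<xi>\<close> the coefficient
  \<open>f = \<langle>\<pi>(\<cdot>)\<xi>|\<pi>(s)\<xi>\<rangle>\<close> has norm one and takes the value one at \<open>s\<close>, so \<open>(f + f\<^sup>2)/2\<close> peaks exactly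
  where \<open>f\<close> is one. Finite products of such functions attain their norm on \<open>B\<close>, whence by
  compactness some \<open>\<omega> \<in> B\<close> satisfies \<open>\<omega>(\<langle>\<pi>(\<cdot>)\<xi>|\<pi>(s)\<xi>\<rangle>) = \<parallel>\<xi>\<parallel>\<^sup>2\<close> for all \<open>\<xi>\<close>
  simultaneously, and polarization shows that \<open>\<omega>\<close> is the evaluation at \<open>s\<close>.\<close>

section \<open>The weak* closure of the evaluations\<close>

text \<open>Collects the algebraic facts behind the general results on boundaries; how
  \<open>rep_algebra \<pi>\<close> is generated enters only in the second section.\<close>

locale function_algebra =
  fixes A :: "('a::topological_space \<Rightarrow>\<^sub>C complex) set"
  assumes add_mem: "f \<in> A \<Longrightarrow> g \<in> A \<Longrightarrow> f + g \<in> A"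
    and cscale_mem: "f \<in> A \<Longrightarrow> cscale c f \<in> A"
    and mult_mem: "f \<in> A \<Longrightarrow> g \<in> A \<Longrightarrow> f * g \<in> A"

section \<open>Weak* continuity and the algebra of characters\<close>

lemma topspace_weak_star: "topspace (weak_star A) = dual_space A"
  by (auto simp: weak_star_def dual_space_def PiE_def)

lemma continuous_map_weak_star_apply:
  assumes "f \<in> A"
  shows "continuous_map (weak_star A) euclidean (\<lambda>\<phi>. \<phi> f)"
  unfolding weak_star_def
  by (rule continuous_map_from_subtopology)
    (rule continuous_map_product_projection[OF assms])

lemma gelfand_spectrumD:
  assumes "\<omega> \<in> gelfand_spectrum A" "f \<in> A"
  shows "g \<in> A \<Longrightarrow> \<omega> (f + g) = \<omega> f + \<omega> g"
    and "\<omega> (cscale c f) = c * \<omega> f"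
    and "g \<in> A \<Longrightarrow> \<omega> (f * g) = \<omega> f * \<omega> g"
  using assms by (simp_all add: gelfand_spectrum_def dual_space_def)

lemma continuous_map_complex_mult:
  fixes f g :: "'b \<Rightarrow> complex"
  assumes "continuous_map X euclidean f" "continuous_map X euclidean g"
  shows "continuous_map X euclidean (\<lambda>x. f x * g x)"
  using assms unfolding continuous_map_atin limitin_canonical_iff by (auto intro: tendsto_mult)

context function_algebra
begin

lemma evaluation_mem_dual: "evaluation A s \<in> dual_space A"
proof -
  have "\<forall>f\<in>A. cmod (evaluation A s f) \<le> 1 * norm f"
    by (simp add: evaluation_def norm_bounded)
  then show ?thesis
    unfolding dual_space_def
    by (auto simp: evaluation_def add_mem cscale_mem intro: exI[of _ 1])
qed

text \<open>A closed condition satisfied by all evaluations passes to their limits. This transfers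
  multiplicativity, the norm bound and, at the end, membership in a boundary.\<close>

lemma evaluation_closure_subset:
  assumes "closedin (weak_star A) C" and "\<And>s. evaluation A s \<in> C"
  shows "evaluation_closure A \<subseteq> C"
  unfolding evaluation_closure_def using assms by (intro closure_of_minimal) auto

lemma evaluation_mem_closure: "evaluation A s \<in> evaluation_closure A"
proof -
  have "range (evaluation A) \<subseteq> evaluation_closure A"
    unfolding evaluation_closure_def
    by (rule closure_of_subset) (auto simp: topspace_weak_star evaluation_mem_dual)
  then show ?thesis by auto
qed

lemma evaluation_closure_dual: "evaluation_closure A \<subseteq> dual_space A"
  by (metis evaluation_closure_def closure_of_subset_topspace topspace_weak_star)

lemma evaluation_closure_mult:
  assumes "f \<in> A" "g \<in> A" "\<phi> \<in> evaluation_closure A"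
  shows "\<phi> (f * g) = \<phi> f * \<phi> g"
proof -
  \<comment> \<open>Written as a difference lying in \<open>{0}\<close>, the identity becomes the
    preimage of a closed set under a weak* continuous map.\<close>
  let ?C = "{\<phi> \<in> topspace (weak_star A). \<phi> (f * g) - \<phi> f * \<phi> g \<in> {0}}"
  have "closedin (weak_star A) ?C"
    using assms mult_mem
    by (intro closedin_continuous_map_preimage[of _ euclidean] continuous_intros
        continuous_map_complex_mult
        continuous_map_weak_star_apply) auto
  then have "evaluation_closure A \<subseteq> ?C"
    by (rule evaluation_closure_subset)
      (use assms evaluation_mem_dual mult_mem in \<open>simp add: topspace_weak_star evaluation_def\<close>)
  then show ?thesis
    using assms by auto
qed

lemma evaluation_closure_norm_le:
  assumes "f \<in> A" "\<phi> \<in> evaluation_closure A"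
  shows "cmod (\<phi> f) \<le> norm f"
proof -
  let ?C = "{\<phi> \<in> topspace (weak_star A). \<phi> f \<in> cball 0 (norm f)}"
  have "closedin (weak_star A) ?C"
    using assms
    by (intro closedin_continuous_map_preimage[of _ euclidean] continuous_map_weak_star_apply) auto
  then have "evaluation_closure A \<subseteq> ?C"
    by (rule evaluation_closure_subset)
      (use assms evaluation_mem_dual in \<open>simp add: topspace_weak_star evaluation_def norm_bounded\<close>)
  then show ?thesis
    using assms by auto
qed

text \<open>Alaoglu's theorem. By Tychonoff the product of the discs \<open>cball 0 (norm f)\<close>
  is compact, and each instance of additivity or homogeneity cuts out a closed subset.\<close>

lemma compactin_dual_ball:
  "compactin (weak_star A) {\<phi> \<in> dual_space A. \<forall>f\<in>A. cmod (\<phi> f) \<le> norm f}"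
proof -
  let ?P = "product_topology (\<lambda>_. euclidean) A :: (('a \<Rightarrow>\<^sub>C complex) \<Rightarrow> complex) topology"
  let ?D = "{\<phi> \<in> dual_space A. \<forall>f\<in>A. cmod (\<phi> f) \<le> norm f}"
  let ?add = "\<lambda>f g. {\<phi> \<in> topspace ?P. \<phi> (f + g) - (\<phi> f + \<phi> g) \<in> {0}}"
  let ?scale = "\<lambda>c f. {\<phi> \<in> topspace ?P. \<phi> (cscale c f) - c * \<phi> f \<in> {0}}"
  \<comment> \<open>The locale allows an empty \<open>A\<close>; inserting
    \<open>topspace ?P\<close> keeps the intersected family nonempty.\<close>
  let ?lin = "\<Inter>(insert (topspace ?P)
    ((\<lambda>(f, g). ?add f g) ` (A \<times> A) \<union> (\<lambda>(c, f). ?scale c f) ` (UNIV \<times> A)))"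
  have ball: "compactin ?P (\<Pi>\<^sub>E f\<in>A. cball 0 (norm f))"
    by (simp add: compactin_PiE compactin_euclidean_iff)
  have "closedin ?P (?add f g)" if "f \<in> A" "g \<in> A" for f g
    using that add_mem
    by (intro closedin_continuous_map_preimage[of _ euclidean] continuous_intros
        continuous_map_complex_mult
        continuous_map_product_projection) auto
  moreover have "closedin ?P (?scale c f)" if "f \<in> A" for c f
    using that cscale_mem
    by (intro closedin_continuous_map_preimage[of _ euclidean] continuous_intros
        continuous_map_complex_mult
        continuous_map_product_projection) auto
  ultimately have lin: "closedin ?P ?lin"
    by (intro closedin_Inter) (auto simp del: topspace_product_topology)
  have "?D = (\<Pi>\<^sub>E f\<in>A. cball 0 (norm f)) \<inter> ?lin"
  proof (intro equalityI subsetI)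
    fix \<phi> assume "\<phi> \<in> ?D"
    then show "\<phi> \<in> (\<Pi>\<^sub>E f\<in>A. cball 0 (norm f)) \<inter> ?lin"
      by (auto simp: dual_space_def PiE_iff)
  next
    fix \<phi> assume *: "\<phi> \<in> (\<Pi>\<^sub>E f\<in>A. cball 0 (norm f)) \<inter> ?lin"
    then have "\<forall>f\<in>A. cmod (\<phi> f) \<le> 1 * norm f"
      by (auto simp: PiE_iff)
    moreover have "\<phi> (f + g) = \<phi> f + \<phi> g" if "f \<in> A" "g \<in> A" for f g
    proof -
      have "\<phi> \<in> ?add f g" using * that by blast
      then show ?thesis by simp
    qed
    moreover have "\<phi> (cscale c f) = c * \<phi> f" if "f \<in> A" for c f
    proof -
      have "\<phi> \<in> ?scale c f" using * that by blast
      then show ?thesis by simp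
    qed
    moreover have "\<phi> \<in> extensional A"
      using * by (auto simp: PiE_iff)
    ultimately show "\<phi> \<in> ?D"
      unfolding dual_space_def by (auto intro: exI[of _ 1])
  qed
  with closed_Int_compactin[OF lin ball] have "compactin ?P ?D"
    by (simp only: Int_commute)
  then show ?thesis
    unfolding weak_star_def compactin_subtopology by auto
qed

lemma compactin_evaluation_closure: "compactin (weak_star A) (evaluation_closure A)"
proof (rule closed_compactin[OF compactin_dual_ball])
  show "evaluation_closure A \<subseteq> {\<phi> \<in> dual_space A. \<forall>f\<in>A. cmod (\<phi> f) \<le> norm f}"
    using evaluation_closure_dual evaluation_closure_norm_le by auto
qed (simp add: evaluation_closure_def)

section \<open>The nonzero limits of evaluations as a boundary\<close>

lemma nonzero_evaluation_closure_eq: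
  "evaluation_closure A - {zero_functional A} = gelfand_spectrum A \<inter> evaluation_closure A"
  using evaluation_closure_dual evaluation_closure_mult
  by (auto simp: gelfand_spectrum_def)

text \<open>Deleting the zero functional from a compact set costs nothing at infinity, since every
  transform vanishes there. The evaluations alone already realize \<open>norm f\<close> as a
  supremum.\<close>

theorem is_boundary_evaluation_closure:
  "is_boundary A (evaluation_closure A - {zero_functional A})" (is "is_boundary A ?E")
  unfolding is_boundary_def
proof (intro conjI ballI)
  show "closedin (subtopology (weak_star A) (gelfand_spectrum A)) ?E"
    unfolding nonzero_evaluation_closure_eq
    by (intro closedin_subtopology_Int_closed) (simp add: evaluation_closure_def)
  have E_dual: "?E \<subseteq> dual_space A"
    using evaluation_closure_dual by auto
  fix f assume f: "f \<in> A"
  have cont: "continuous_map (weak_star A) euclidean (gelfand_transform f)"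
    unfolding gelfand_transform_def[abs_def] by (rule continuous_map_weak_star_apply[OF f])
  show "gelfand_transform f \<in> C0_space (subtopology (weak_star A) ?E)"
    unfolding C0_space_def
  proof (intro CollectI conjI allI impI)
    show "continuous_map (subtopology (weak_star A) ?E) euclidean (gelfand_transform f)"
      by (rule continuous_map_from_subtopology[OF cont])
    fix e :: real assume "e > 0"
    \<comment> \<open>A closed part of the compact closure; it misses the zero functional because
      \<open>e > 0\<close>.\<close>
    let ?K = "{\<phi> \<in> topspace (weak_star A). gelfand_transform f \<phi> \<in> - ball 0 e} \<inter>
      evaluation_closure A"
    have "closedin (weak_star A) {\<phi> \<in> topspace (weak_star A). gelfand_transform f \<phi> \<in> - ball 0 e}"
      by (rule closedin_continuous_map_preimage[OF cont]) auto
    then have "compactin (weak_star A) ?K"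
      by (rule closed_Int_compactin[OF _ compactin_evaluation_closure])
    moreover have "?K \<subseteq> ?E"
      using \<open>e > 0\<close> f by (auto simp: gelfand_transform_def zero_functional_def)
    ultimately have "compactin (subtopology (weak_star A) ?E) ?K"
      by (simp add: compactin_subtopology)
    moreover have "\<forall>\<phi>\<in>topspace (subtopology (weak_star A) ?E) - ?K. cmod (gelfand_transform f \<phi>) < e"
      by auto
    ultimately show "\<exists>K. compactin (subtopology (weak_star A) ?E) K \<and>
        (\<forall>\<phi>\<in>topspace (subtopology (weak_star A) ?E) - K. cmod (gelfand_transform f \<phi>) < e)"
      by blast
  qed
  let ?S = "insert 0 ((\<lambda>\<phi>. cmod (gelfand_transform f \<phi>)) ` ?E)"
  have le: "x \<le> norm f" if "x \<in> ?S" for x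
    using that f evaluation_closure_norm_le by (auto simp: gelfand_transform_def)
  then have bdd: "bdd_above ?S"
    by (rule bdd_aboveI)
  have "cmod (apply_bcontfun f s) \<le> Sup ?S" for s
  proof (rule cSup_upper[OF _ bdd])
    \<comment> \<open>An evaluation that is zero has left \<open>?E\<close>, but its value 0 is
      still covered by the inserted 0.\<close>
    have "evaluation A s = zero_functional A \<Longrightarrow> apply_bcontfun f s = 0"
      using f by (metis evaluation_def zero_functional_def restrict_apply')
    moreover have "apply_bcontfun f s = gelfand_transform f (evaluation A s)"
      using f by (simp add: gelfand_transform_def evaluation_def)
    ultimately show "cmod (apply_bcontfun f s) \<in> ?S"
      using evaluation_mem_closure[of s] by (cases "evaluation A s = zero_functional A") auto
  qed
  then have "norm f \<le> Sup ?S"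
    by (rule norm_bound)
  moreover have "Sup ?S \<le> norm f"
    by (rule cSup_least[OF _ le]) auto
  ultimately show "sup_norm_on ?E (gelfand_transform f) = norm f"
    by (simp add: sup_norm_on_def)
qed

section \<open>Norms on an arbitrary boundary\<close>

lemma topspace_boundary:
  assumes "is_boundary A B"
  shows "topspace (subtopology (weak_star A) B) = B"
  using closedin_subset[of "subtopology (weak_star A) (gelfand_spectrum A)" B] assms
  by (auto simp: is_boundary_def)

text \<open>A real supremum bounds its set only once the set is known to be bounded above. Vanishing
  at infinity gives this: the modulus is below 1 off a compact set and bounded on it.\<close>

lemma boundary_norm_le:
  assumes B: "is_boundary A B" and "f \<in> A" "\<omega> \<in> B"
  shows "cmod (\<omega> f) \<le> norm f"
proof -
  let ?X = "subtopology (weak_star A) B"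
  let ?S = "insert 0 ((\<lambda>\<phi>. cmod (gelfand_transform f \<phi>)) ` B)"
  have C0: "gelfand_transform f \<in> C0_space ?X" and Sup: "sup_norm_on B (gelfand_transform f) = norm f"
    using B \<open>f \<in> A\<close> by (auto simp: is_boundary_def)
  have top: "topspace ?X = B"
    by (rule topspace_boundary[OF B])
  obtain K where K: "compactin ?X K" "\<And>\<phi>. \<phi> \<in> B - K \<Longrightarrow> cmod (gelfand_transform f \<phi>) < 1"
    using C0 top unfolding C0_space_def by (auto dest!: spec[of _ "1::real"])
  have "bounded (gelfand_transform f ` K)"
    using image_compactin[OF K(1), of euclidean "gelfand_transform f"] C0
    by (simp add: C0_space_def compact_imp_bounded)
  then obtain b where b: "\<And>\<phi>. \<phi> \<in> K \<Longrightarrow> cmod (gelfand_transform f \<phi>) \<le> b"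
    unfolding bounded_iff by blast
  have "x \<le> max 1 b" if "x \<in> ?S" for x
    using that b K(2) by (force simp: le_max_iff_disj)
  then have "bdd_above ?S"
    by (rule bdd_aboveI)
  moreover have "cmod (\<omega> f) \<in> ?S"
    using \<open>\<omega> \<in> B\<close> by (auto simp: gelfand_transform_def)
  ultimately show ?thesis
    using cSup_upper Sup unfolding sup_norm_on_def by metis
qed

text \<open>Vanishing at infinity puts this closed set inside a compact one. It replaces
  \<open>B\<close>, which need not be compact, in the compactness arguments below.\<close>

lemma compactin_boundary_superlevel:
  assumes B: "is_boundary A B" and f: "f \<in> A" and "e > 0"
  shows "compactin (weak_star A) {\<omega> \<in> B. e \<le> cmod (\<omega> f)}"
proof -
  let ?X = "subtopology (weak_star A) B"
  have C0: "gelfand_transform f \<in> C0_space ?X"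
    using B f by (auto simp: is_boundary_def)
  have top: "topspace ?X = B"
    by (rule topspace_boundary[OF B])
  obtain K where K: "compactin ?X K" "\<And>\<phi>. \<phi> \<in> B - K \<Longrightarrow> cmod (gelfand_transform f \<phi>) < e"
    using C0 top \<open>e > 0\<close> unfolding C0_space_def by auto
  have "closedin ?X {\<omega> \<in> topspace ?X. gelfand_transform f \<omega> \<in> - ball 0 e}"
    using C0 by (intro closedin_continuous_map_preimage[of _ euclidean]) (auto simp: C0_space_def)
  moreover have "{\<omega> \<in> topspace ?X. gelfand_transform f \<omega> \<in> - ball 0 e} \<subseteq> K"
    using K(2) top by force
  ultimately have "compactin ?X {\<omega> \<in> topspace ?X. gelfand_transform f \<omega> \<in> - ball 0 e}"
    by (metis K(1) closed_compactin)
  then have "compactin (weak_star A) {\<omega> \<in> B. gelfand_transform f \<omega> \<in> - ball 0 e}"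
    unfolding top by (simp add: compactin_subtopology)
  then show ?thesis
    by (simp add: gelfand_transform_def not_less)
qed

lemma boundary_attains_norm:
  assumes B: "is_boundary A B" and f: "f \<in> A" and "f \<noteq> 0"
  obtains \<omega> where "\<omega> \<in> B" "cmod (\<omega> f) = norm f"
proof -
  \<comment> \<open>Any level strictly between 0 and \<open>norm f\<close> would serve: positive for
    compactness, below the norm for nonemptiness.\<close>
  let ?K = "{\<omega> \<in> B. norm f / 2 \<le> cmod (\<omega> f)}"
  have pos: "norm f > 0" using \<open>f \<noteq> 0\<close> by simp
  have Sup: "Sup (insert 0 ((\<lambda>\<omega>. cmod (\<omega> f)) ` B)) = norm f"
    using B f by (simp add: is_boundary_def sup_norm_on_def gelfand_transform_def)
  \<comment> \<open>The condition \<open>0 \<le> e\<close> keeps the inserted 0 from being the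
    element above \<open>e\<close>.\<close>
  have approx: "\<exists>\<omega>\<in>B. e < cmod (\<omega> f)" if e: "0 \<le> e" "e < norm f" for e
  proof -
    obtain x where "x \<in> insert 0 ((\<lambda>\<omega>. cmod (\<omega> f)) ` B)" "e < x"
      using less_cSupE[of e "insert 0 ((\<lambda>\<omega>. cmod (\<omega> f)) ` B)"] e(2) Sup by (metis insert_not_empty)
    then show ?thesis using e by auto
  qed
  have "compactin (weak_star A) ?K"
    by (rule compactin_boundary_superlevel[OF B f]) (use pos in simp)
  then have "compact ((\<lambda>\<omega>. \<omega> f) ` ?K)"
    using image_compactin[OF _ continuous_map_weak_star_apply[OF f]] by auto
  then have cpt: "compact (cmod ` (\<lambda>\<omega>. \<omega> f) ` ?K)"
    by (rule compact_continuous_image[rotated]) (intro continuous_intros)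
  moreover have "?K \<noteq> {}"
    using approx[of "norm f / 2"] pos by force
  ultimately obtain \<omega> where \<omega>: "\<omega> \<in> ?K" "\<And>\<psi>. \<psi> \<in> ?K \<Longrightarrow> cmod (\<psi> f) \<le> cmod (\<omega> f)"
    using compact_attains_sup[OF cpt] by auto
  \<comment> \<open>A character exceeding the maximum on \<open>?K\<close> would itself lie in
    \<open>?K\<close>.\<close>
  have "\<not> cmod (\<omega> f) < norm f"
  proof
    assume "cmod (\<omega> f) < norm f"
    with approx[of "cmod (\<omega> f)"] obtain \<psi> where "\<psi> \<in> B" "cmod (\<omega> f) < cmod (\<psi> f)" by auto
    with \<omega> show False by force
  qed
  moreover have "cmod (\<omega> f) \<le> norm f"
    using boundary_norm_le[OF B f] \<omega>(1) by simp
  ultimately show ?thesis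
    using that \<omega>(1) by auto
qed

section \<open>Peak functions and their common peak points\<close>

lemma boundary_character:
  assumes "is_boundary A B" "\<omega> \<in> B"
  shows "\<omega> \<in> gelfand_spectrum A"
  using closedin_subset[of "subtopology (weak_star A) (gelfand_spectrum A)" B] assms
  by (auto simp: is_boundary_def)

text \<open>Averaging \<open>f\<close> with its square turns a statement on modulus into one on
  value: for \<open>c = \<omega> f\<close> in the unit disc, \<open>c * (1 + c) / 2\<close> has
  modulus 1 only if \<open>1 + c\<close> has modulus 2, hence only if \<open>c = 1\<close>.\<close>

lemma boundary_peak:
  assumes B: "is_boundary A B" and f: "f \<in> A" "norm f \<le> 1" "apply_bcontfun f s = 1"
  shows "\<exists>g\<in>A. norm g \<le> 1 \<and> apply_bcontfun g s = 1 \<and>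
    (\<forall>\<omega>\<in>B. cmod (\<omega> g) = 1 \<longrightarrow> \<omega> f = 1)"
proof -
  let ?g = "cscale (1 / 2) (f + f * f)"
  have mem: "f * f \<in> A" "f + f * f \<in> A" "?g \<in> A"
    using f add_mem cscale_mem mult_mem by auto
  have fx: "cmod (apply_bcontfun f x) \<le> 1" for x
    using norm_bounded[of f x] f(2) by linarith
  have "cmod (apply_bcontfun f x + apply_bcontfun f x * apply_bcontfun f x) \<le> 1 + 1 * 1" for x
    using fx by (intro order_trans[OF norm_triangle_ineq] add_mono)
      (auto simp: norm_mult intro: mult_le_one)
  then have "norm ?g \<le> 1"
    by (intro norm_bound) (simp add: norm_mult norm_divide)
  moreover have "\<omega> f = 1" if \<omega>: "\<omega> \<in> B" "cmod (\<omega> ?g) = 1" for \<omega>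
  proof -
    let ?c = "\<omega> f"
    have "\<omega> ?g = 1 / 2 * (?c + ?c * ?c)"
      by (simp only: gelfand_spectrumD[OF boundary_character[OF B \<omega>(1)]] mem f)
    also have "\<dots> = ?c * (1 + ?c) / 2"
      by (simp add: algebra_simps)
    finally have "cmod (?c * (1 + ?c) / 2) = 1"
      using \<omega>(2) by (simp only:)
    then have "cmod ?c * cmod (1 + ?c) = 2"
      by (simp only: norm_divide norm_mult) simp
    moreover have c: "cmod ?c \<le> 1"
      using boundary_norm_le[OF B f(1) \<omega>(1)] f(2) by linarith
    ultimately have "2 \<le> cmod (1 + ?c)"
      using mult_right_mono[OF c, of "cmod (1 + ?c)"] by simp
    then have "4 \<le> (cmod (1 + ?c))\<^sup>2"
      using power_mono[of 2 "cmod (1 + ?c)" 2] by simp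
    moreover have "(cmod ?c)\<^sup>2 \<le> 1"
      using c by (simp add: power_le_one)
    \<comment> \<open>Comparing this expansion with the lower bound 4 forces the real part up to 1;
      the disc then leaves no room for an imaginary part.\<close>
    moreover have "(cmod (1 + ?c))\<^sup>2 = 1 + 2 * Re ?c + (cmod ?c)\<^sup>2"
      unfolding cmod_power2 by (simp add: power2_eq_square algebra_simps)
    ultimately have "1 \<le> Re ?c" by linarith
    with \<open>(cmod ?c)\<^sup>2 \<le> 1\<close> have "Re ?c = 1"
      using complex_Re_le_cmod[of ?c] c by linarith
    with \<open>(cmod ?c)\<^sup>2 \<le> 1\<close> show ?thesis
      by (simp add: cmod_power2 complex_eq_iff)
  qed
  ultimately show ?thesis
    using f mem by (intro bexI[of _ ?g]) auto
qed

text \<open>A product of numbers in the unit disc has modulus 1 only if every factor has, so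
  multiplying peak functions intersects their peak sets. The family is nonempty because the empty
  product, the constant 1, may lie outside \<open>A\<close>.\<close>

lemma boundary_peak_product:
  assumes B: "is_boundary A B" and "finite F" "F \<noteq> {}"
    and F: "\<And>f. f \<in> F \<Longrightarrow> f \<in> A \<and> norm f \<le> 1 \<and> apply_bcontfun f s = 1"
  shows "\<exists>g\<in>A. norm g \<le> 1 \<and> apply_bcontfun g s = 1 \<and>
    (\<forall>\<omega>\<in>B. cmod (\<omega> g) = 1 \<longrightarrow> (\<forall>f\<in>F. \<omega> f = 1))"
  using \<open>finite F\<close> \<open>F \<noteq> {}\<close> F
proof (induction F rule: finite_ne_induct)
  case (singleton f)
  then show ?case using boundary_peak[OF B, of f s] by auto
next
  case (insert f F)
  obtain g where g: "g \<in> A" "norm g \<le> 1" "apply_bcontfun g s = 1"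
    "\<And>\<omega>. \<omega> \<in> B \<Longrightarrow> cmod (\<omega> g) = 1 \<Longrightarrow> \<forall>f\<in>F. \<omega> f = 1"
    using insert by auto
  obtain h where h: "h \<in> A" "norm h \<le> 1" "apply_bcontfun h s = 1"
    "\<And>\<omega>. \<omega> \<in> B \<Longrightarrow> cmod (\<omega> h) = 1 \<Longrightarrow> \<omega> f = 1"
    using boundary_peak[OF B, of f s] insert.prems by auto
  have "norm (g * h) \<le> 1"
    using g(2) h(2) norm_mult_ineq[of g h] mult_le_one[of "norm g" "norm h"] by simp
  moreover have "cmod (\<omega> g) = 1 \<and> cmod (\<omega> h) = 1" if "\<omega> \<in> B" "cmod (\<omega> (g * h)) = 1" for \<omega>
  proof -
    have "cmod (\<omega> g) * cmod (\<omega> h) = 1"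
      using that(2)
      by (simp only: gelfand_spectrumD(3)[OF boundary_character[OF B that(1)] g(1) h(1)] norm_mult)
    moreover have "cmod (\<omega> g) \<le> 1" "cmod (\<omega> h) \<le> 1"
      using boundary_norm_le[OF B g(1) that(1)] boundary_norm_le[OF B h(1) that(1)] g(2) h(2)
      by auto
    ultimately show ?thesis
      by (smt (verit) mult_left_le mult.commute norm_ge_zero)
  qed
  ultimately show ?case
    using g h mult_mem by (intro bexI[of _ "g * h"]) auto
qed

text \<open>Finite intersection property: for finitely many members of \<open>P\<close>, the product
  peak function attains its norm on \<open>B\<close>, at a character sending all of them to 1. One
  fixed \<open>f0\<close> supplies the compact set.\<close>

lemma boundary_meets_peak_sets:
  assumes B: "is_boundary A B" and "P \<noteq> {}"
    and P: "\<And>f. f \<in> P \<Longrightarrow> f \<in> A \<and> norm f \<le> 1 \<and> apply_bcontfun f s = 1"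
  obtains \<omega> where "\<omega> \<in> B" "\<And>f. f \<in> P \<Longrightarrow> \<omega> f = 1"
proof -
  obtain f0 where f0: "f0 \<in> P" using \<open>P \<noteq> {}\<close> by auto
  let ?K = "{\<omega> \<in> B. 1 \<le> cmod (\<omega> f0)}"
  let ?Z = "\<lambda>f. {\<omega> \<in> topspace (weak_star A). \<omega> f \<in> {1}}"
  have cpt: "compactin (weak_star A) ?K"
    using compactin_boundary_superlevel[OF B] P[OF f0] by simp
  have closed: "closedin (weak_star A) C" if C: "C \<in> ?Z ` P" for C
  proof -
    from C obtain f where "C = ?Z f" "f \<in> P" by auto
    then show ?thesis
      using P closedin_continuous_map_preimage[OF continuous_map_weak_star_apply[of f A], of "{1}"]
      by auto
  qed
  have fip: "?K \<inter> \<Inter>\<F> \<noteq> {}" if \<F>: "finite \<F>" "\<F> \<subseteq> ?Z ` P" for \<F>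
  proof -
    obtain F where F: "finite F" "F \<subseteq> P" "\<F> = ?Z ` F"
      using finite_subset_image[OF \<F>] by auto
    \<comment> \<open>Adding \<open>f0\<close> makes the family nonempty and forces the resulting
      character into \<open>?K\<close>.\<close>
    obtain g where g: "g \<in> A" "norm g \<le> 1" "apply_bcontfun g s = 1"
      "\<And>\<omega>. \<omega> \<in> B \<Longrightarrow> cmod (\<omega> g) = 1 \<Longrightarrow> \<forall>f\<in>insert f0 F. \<omega> f = 1"
      using boundary_peak_product[OF B, of "insert f0 F" s] F f0 P by blast
    have "norm g = 1"
      using g(2,3) norm_bounded[of g s] by simp
    moreover from this have "g \<noteq> 0" by auto
    ultimately obtain \<omega> where \<omega>: "\<omega> \<in> B" "cmod (\<omega> g) = 1"
      using boundary_attains_norm[OF B g(1)] by metis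
    moreover have "\<omega> \<in> topspace (weak_star A)"
      using boundary_character[OF B \<omega>(1)] by (simp add: topspace_weak_star gelfand_spectrum_def)
    ultimately have "\<omega> \<in> ?K \<inter> \<Inter>\<F>"
      using g(4)[OF \<omega>] F(3) by auto
    then show ?thesis by blast
  qed
  have "?K \<inter> \<Inter>(?Z ` P) \<noteq> {}"
    by (rule cpt[unfolded compactin_fip, THEN conjunct2, rule_format, of "?Z ` P"])
      (use closed fip in simp)
  then show ?thesis
    using that by auto
qed

end

section \<open>Evaluations on the algebra of a representation\<close>

lemma function_algebra_closure_generated: "function_algebra (closure (generated_alg F))"
proof
  fix f g and c :: complex
  assume f: "f \<in> closure (generated_alg F)"
  then obtain u where u: "\<And>n. u n \<in> generated_alg F" "u \<longlonglongrightarrow> f"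
    unfolding closure_sequential by auto
  show "cscale c f \<in> closure (generated_alg F)"
    unfolding closure_sequential
    using u by (auto intro!: exI[of _ "\<lambda>n. cscale c (u n)"] tendsto_intros generated_alg.scale)
  assume g: "g \<in> closure (generated_alg F)"
  then obtain v where v: "\<And>n. v n \<in> generated_alg F" "v \<longlonglongrightarrow> g"
    unfolding closure_sequential by auto
  show "f + g \<in> closure (generated_alg F)"
    unfolding closure_sequential
    using u v by (auto intro!: exI[of _ "\<lambda>n. u n + v n"] tendsto_intros generated_alg.add)
  show "f * g \<in> closure (generated_alg F)"
    unfolding closure_sequential
    using u v by (auto intro!: exI[of _ "\<lambda>n. u n * v n"] tendsto_intros generated_alg.mult)
qed

lemma function_algebra_rep_algebra: "function_algebra (rep_algebra \<pi>)"
  unfolding rep_algebra_def by (rule function_algebra_closure_generated)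

lemma matrix_coeff_mem_rep_algebra: "matrix_coeff \<pi> \<xi> \<eta> \<in> rep_algebra \<pi>"
proof -
  have "matrix_coeff \<pi> \<xi> \<eta> \<in> coeff_space \<pi>"
    unfolding coeff_space_def by (rule complex_bcontfun.span_base) auto
  then show ?thesis
    unfolding rep_algebra_def using closure_subset generated_alg.base by blast
qed

text \<open>Agreement on coefficients extends by linearity to their span, by induction over the
  operations to the generated algebra, and by boundedness to its closure.\<close>

lemma character_eq_evaluation:
  fixes \<omega> :: "('g::topological_group_add \<Rightarrow>\<^sub>C complex) \<Rightarrow> complex"
  assumes \<omega>: "\<omega> \<in> gelfand_spectrum (rep_algebra \<pi>)"
    and coeff: "\<And>\<xi> \<eta>. \<omega> (matrix_coeff \<pi> \<xi> \<eta>) = apply_bcontfun (matrix_coeff \<pi> \<xi> \<eta>) s"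
  shows "\<omega> = evaluation (rep_algebra \<pi>) s"
proof -
  let ?A = "rep_algebra \<pi>" and ?G = "generated_alg (coeff_space \<pi>)"
  interpret function_algebra ?A by (rule function_algebra_rep_algebra)
  have GA: "?G \<subseteq> ?A"
    unfolding rep_algebra_def by (rule closure_subset)
  note add = gelfand_spectrumD(1)[OF \<omega>] and scale = gelfand_spectrumD(2)[OF \<omega>]
    and mult = gelfand_spectrumD(3)[OF \<omega>]
  obtain K where K: "\<And>f. f \<in> ?A \<Longrightarrow> cmod (\<omega> f) \<le> K * norm f"
    using \<omega> unfolding gelfand_spectrum_def dual_space_def by blast
  have zero: "0 \<in> ?A"
    using GA generated_alg.zero by auto
  have zero': "\<omega> 0 = 0"
    using add[OF zero zero] by simp
  have span: "f \<in> ?A \<and> \<omega> f = apply_bcontfun f s" if "f \<in> coeff_space \<pi>" for f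
    using that unfolding coeff_space_def
  proof (induction rule: complex_bcontfun.span_induct_alt)
    case base
    then show ?case using zero zero' by simp
  next
    case (step c x y)
    then have x: "x \<in> ?A" "\<omega> x = apply_bcontfun x s"
      using matrix_coeff_mem_rep_algebra coeff by auto
    with step show ?case
      by (auto simp: add_mem cscale_mem add scale)
  qed
  have gen: "\<omega> f = apply_bcontfun f s" if "f \<in> ?G" for f
    using that
  proof induction
    case (base f)
    then show ?case using span by auto
  qed (use GA zero' add scale mult in \<open>auto simp: subset_iff\<close>)
  have "\<omega> f = apply_bcontfun f s" if f: "f \<in> ?A" for f
  proof -
    obtain u where u: "\<And>n. u n \<in> ?G" "u \<longlonglongrightarrow> f"
      using f unfolding rep_algebra_def closure_sequential by auto
    \<comment> \<open>The difference is built from addition and scaling by -1, the operations for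
      which closure of \<open>?A\<close> and linearity of \<open>\<omega>\<close> are
      stated.\<close>
    have diff: "f + cscale (-1) (u n) \<in> ?A" for n
      using f u GA by (intro add_mem cscale_mem) auto
    \<comment> \<open>Both functionals agree at \<open>u n\<close>, so only their values at
      \<open>f - u n\<close> remain: \<open>K\<close> bounds the character, 1 the
      evaluation.\<close>
    have "cmod (\<omega> f - apply_bcontfun f s) \<le> (K + 1) * dist f (u n)" for n
    proof -
      have un: "u n \<in> ?A"
        using u GA by auto
      have eq: "f + cscale (-1) (u n) = f - u n"
        by (intro bcontfun_eqI) simp
      have "\<omega> (f - u n) = \<omega> f - apply_bcontfun (u n) s"
        using add[OF f cscale_mem[OF un, of "-1"]] scale[OF un, of "-1"] gen[OF u(1)]
        unfolding eq by simp
      then have "\<omega> f - apply_bcontfun f s = \<omega> (f - u n) - apply_bcontfun (f - u n) s"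
        by simp
      also have "cmod \<dots> \<le> K * norm (f - u n) + norm (f - u n)"
        using K[OF diff[of n]] norm_bounded[of "f - u n" s] norm_triangle_ineq4
        unfolding eq by (smt (verit))
      finally show ?thesis
        by (simp add: dist_norm algebra_simps)
    qed
    moreover have "(\<lambda>n. (K + 1) * dist f (u n)) \<longlonglongrightarrow> (K + 1) * dist f f"
      by (intro tendsto_intros u(2))
    ultimately have "cmod (\<omega> f - apply_bcontfun f s) \<le> 0"
      by (intro LIMSEQ_le_const[of _ 0]) auto
    then show ?thesis by simp
  qed
  moreover have "\<omega> \<in> extensional ?A"
    using \<omega> by (auto simp: gelfand_spectrum_def dual_space_def)
  ultimately show ?thesis
    by (intro extensionalityI[of _ ?A]) (auto simp: evaluation_def)
qed

text \<open>Polarization: the diagonal at \<open>x + y\<close> makes \<open>D\<close> antisymmetric;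
  replacing \<open>x\<close> by \<open>\<i>\<close> times \<open>x\<close>, which scales the two
  arguments oppositely, makes it symmetric.\<close>

lemma sesquilinear_eq_zero:
  fixes D :: "'h::complex_hilbert_space \<Rightarrow> 'h \<Rightarrow> complex"
  assumes "\<And>x y z. D (x + y) z = D x z + D y z" "\<And>x y z. D z (x + y) = D z x + D z y"
    and "\<And>c x y. D (scaleC c x) y = c * D x y" "\<And>c x y. D x (scaleC c y) = cnj c * D x y"
    and diag: "\<And>x. D x x = 0"
  shows "D x y = 0"
proof -
  have *: "D x y + D y x = 0" for x y
  proof -
    have "D (x + y) (x + y) = D x x + D x y + (D y x + D y y)"
      by (simp only: assms(1,2) ac_simps)
    then show ?thesis by (simp add: diag)
  qed
  have "\<i> * D x y - \<i> * D y x = 0"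
    using *[of "scaleC \<i> x" y] by (simp add: assms(3,4))
  then have "D x y = D y x" by simp
  with *[of x y] show ?thesis by simp
qed

section \<open>Coefficients of a unitary representation as peak functions\<close>

lemma unitary_rep_norm:
  assumes "continuous_unitary_rep \<pi>"
  shows "norm (\<pi> s \<xi>) = norm \<xi>"
proof -
  have "cinner (\<pi> s \<xi>) (\<pi> s \<xi>) = cinner \<xi> \<xi>"
    using assms by (simp add: continuous_unitary_rep_def unitary_op_def)
  then have "(norm (\<pi> s \<xi>))\<^sup>2 = (norm \<xi>)\<^sup>2"
    unfolding cinner_self of_real_eq_iff .
  then show ?thesis by simp
qed

lemma norm_matrix_coeff_le:
  assumes "continuous_unitary_rep \<pi>"
  shows "norm (matrix_coeff \<pi> \<xi> \<eta>) \<le> norm \<xi> * norm \<eta>"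
  by (rule norm_bound)
    (metis apply_matrix_coeff[OF assms] cmod_cinner_le unitary_rep_norm[OF assms])

text \<open>Some character in \<open>B\<close> matches the evaluation on diagonal coefficients,
  polarization extends this to all coefficients, and these determine a character. On the zero space
  the claim fails, since the evaluation is then the zero functional.\<close>

lemma evaluation_mem_boundary:
  fixes \<pi> :: "'g::topological_group_add \<Rightarrow> 'h::complex_hilbert_space \<Rightarrow> 'h"
  assumes \<pi>: "continuous_unitary_rep \<pi>" and B: "is_boundary (rep_algebra \<pi>) B"
    and nontriv: "\<exists>\<xi>::'h. \<xi> \<noteq> 0"
  shows "evaluation (rep_algebra \<pi>) s \<in> B"
proof -
  let ?A = "rep_algebra \<pi>"
  interpret function_algebra ?A by (rule function_algebra_rep_algebra)
  \<comment> \<open>Moving the second vector by \<open>\<pi> s\<close> makes the value at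
    \<open>s\<close> equal to \<open>cinner \<xi> \<eta>\<close>, by unitarity.\<close>
  let ?f = "\<lambda>\<xi> \<eta>. matrix_coeff \<pi> \<xi> (\<pi> s \<eta>)"
  have apply_f: "apply_bcontfun (?f \<xi> \<eta>) t = cinner (\<pi> t \<xi>) (\<pi> s \<eta>)" for \<xi> \<eta> t
    by (rule apply_matrix_coeff[OF \<pi>])
  have op: "unitary_op (\<pi> t)" for t
    using \<pi> by (auto simp: continuous_unitary_rep_def)
  have inner: "apply_bcontfun (?f \<xi> \<eta>) s = cinner \<xi> \<eta>" for \<xi> \<eta>
    using op[of s] by (simp add: apply_f unitary_op_def)
  let ?P = "{?f \<xi> \<xi> | \<xi>. norm \<xi> = 1}"
  obtain \<xi>0 :: 'h where "\<xi>0 \<noteq> 0" using nontriv by auto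
  then have "norm (\<xi>0 /\<^sub>R norm \<xi>0) = 1" by simp
  then have "?P \<noteq> {}" by blast
  moreover have "f \<in> ?A \<and> norm f \<le> 1 \<and> apply_bcontfun f s = 1" if f: "f \<in> ?P" for f
  proof -
    obtain \<xi> where \<xi>: "f = ?f \<xi> \<xi>" "norm \<xi> = 1" using f by blast
    then show ?thesis
      using norm_matrix_coeff_le[OF \<pi>, of \<xi> "\<pi> s \<xi>"]
      by (simp add: matrix_coeff_mem_rep_algebra unitary_rep_norm[OF \<pi>] inner cinner_self)
  qed
  ultimately obtain \<omega> where \<omega>: "\<omega> \<in> B" "\<And>f. f \<in> ?P \<Longrightarrow> \<omega> f = 1"
    using boundary_meets_peak_sets[OF B, of ?P s] by blast
  have spec: "\<omega> \<in> gelfand_spectrum ?A"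
    by (rule boundary_character[OF B \<omega>(1)])
  \<comment> \<open>The defect between \<open>\<omega>\<close> and the evaluation at
    \<open>s\<close>; it is sesquilinear, so its diagonal decides whether it vanishes.\<close>
  let ?D = "\<lambda>\<xi> \<eta>. \<omega> (?f \<xi> \<eta>) - cinner \<xi> \<eta>"
  have mem: "?f \<xi> \<eta> \<in> ?A" for \<xi> \<eta>
    by (rule matrix_coeff_mem_rep_algebra)
  have lin: "\<omega> (?f (x + y) z) = \<omega> (?f x z) + \<omega> (?f y z)"
      "\<omega> (?f z (x + y)) = \<omega> (?f z x) + \<omega> (?f z y)"
      "\<omega> (?f (scaleC c x) z) = c * \<omega> (?f x z)"
      "\<omega> (?f x (scaleC c z)) = cnj c * \<omega> (?f x z)" for x y z c
  proof -
    have "?f (x + y) z = ?f x z + ?f y z" "?f z (x + y) = ?f z x + ?f z y"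
      "?f (scaleC c x) z = cscale c (?f x z)" "?f x (scaleC c z) = cscale (cnj c) (?f x z)"
      using op unfolding unitary_op_def
      by (auto intro!: bcontfun_eqI simp: apply_matrix_coeff[OF \<pi>]
          cinner_add_left cinner_add_right cinner_scaleC_left cinner_scaleC_right)
    then show "\<omega> (?f (x + y) z) = \<omega> (?f x z) + \<omega> (?f y z)"
      "\<omega> (?f z (x + y)) = \<omega> (?f z x) + \<omega> (?f z y)"
      "\<omega> (?f (scaleC c x) z) = c * \<omega> (?f x z)"
      "\<omega> (?f x (scaleC c z)) = cnj c * \<omega> (?f x z)"
      by (simp_all only: gelfand_spectrumD[OF spec] mem)
  qed
  have diag: "?D \<xi> \<xi> = 0" for \<xi>
  proof -
    \<comment> \<open>Only unit vectors are controlled by \<open>?P\<close>; the zero vector is 0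
      times any unit vector.\<close>
    obtain c u where u: "norm u = 1" "\<xi> = scaleC c u"
    proof (cases "\<xi> = 0")
      case True
      then show ?thesis
        using that[of "\<xi>0 /\<^sub>R norm \<xi>0" 0] \<open>\<xi>0 \<noteq> 0\<close> scaleC_of_real[of 0 "\<xi>0 /\<^sub>R norm \<xi>0"] by simp
    next
      case False
      then show ?thesis
        using that[of "\<xi> /\<^sub>R norm \<xi>" "complex_of_real (norm \<xi>)"] by (simp add: scaleC_of_real)
    qed
    have "\<omega> (?f u u) = 1"
      using \<omega>(2) u(1) by blast
    then have "?D u u = 0"
      using u(1) by (simp add: cinner_self)
    then show ?thesis
      by (simp add: u(2) lin cinner_scaleC_left cinner_scaleC_right)
  qed
  have "?D \<xi> \<eta> = 0" for \<xi> \<eta>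
    by (rule sesquilinear_eq_zero[of ?D])
      (use diag in \<open>auto simp: lin cinner_add_left cinner_add_right cinner_scaleC_left
        cinner_scaleC_right algebra_simps\<close>)
  then have f: "\<omega> (?f \<xi> \<eta>) = apply_bcontfun (?f \<xi> \<eta>) s" for \<xi> \<eta>
    by (simp add: inner)
  have "\<omega> (matrix_coeff \<pi> \<xi> \<eta>) = apply_bcontfun (matrix_coeff \<pi> \<xi> \<eta>) s" for \<xi> \<eta>
  proof -
    \<comment> \<open>Since \<open>\<pi> s\<close> is onto, every coefficient is one of the shifted
      ones.\<close>
    obtain \<zeta> where "\<eta> = \<pi> s \<zeta>"
      using op[of s] unfolding unitary_op_def by (metis surjD)
    then show ?thesis using f by simp
  qed
  then show ?thesis
    using character_eq_evaluation[OF spec] \<omega>(1) by metis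
qed

text \<open>Separates off the zero Hilbert space, which has no unit vectors and so no peaking
  coefficients.\<close>

lemma rep_algebra_trivial:
  fixes \<pi> :: "'g::topological_group_add \<Rightarrow> 'h::complex_hilbert_space \<Rightarrow> 'h"
  assumes \<pi>: "continuous_unitary_rep \<pi>" and "\<And>\<xi>::'h. \<xi> = 0"
  shows "rep_algebra \<pi> = {0}"
proof -
  have "matrix_coeff \<pi> \<xi> \<eta> = 0" for \<xi> \<eta>
    using norm_matrix_coeff_le[OF \<pi>, of \<xi> \<eta>] assms(2)[of \<xi>] by simp
  then have "{matrix_coeff \<pi> \<xi> \<eta> | \<xi> \<eta>. True} = {0}"
    by auto
  then have coeff: "coeff_space \<pi> = {0}"
    by (simp add: coeff_space_def)
  have "f = 0" if "f \<in> generated_alg (coeff_space \<pi>)" for f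
    using that by induction (auto simp: coeff)
  then have "generated_alg (coeff_space \<pi>) = {0}"
    using generated_alg.zero by blast
  then show ?thesis
    by (simp add: rep_algebra_def)
qed

theorem theorem3p10:
  fixes \<pi> :: "'g::{topological_group_add, t2_space} \<Rightarrow> 'h::complex_hilbert_space \<Rightarrow> 'h"
  assumes "locally_compact_space (euclidean :: 'g topology)"
    and "continuous_unitary_rep \<pi>"
  shows "silov_boundary (rep_algebra \<pi>) =
    evaluation_closure (rep_algebra \<pi>) - {zero_functional (rep_algebra \<pi>)}"
proof
  let ?A = "rep_algebra \<pi>"
  interpret function_algebra ?A by (rule function_algebra_rep_algebra)
  show "silov_boundary ?A \<subseteq> evaluation_closure ?A - {zero_functional ?A}"
    unfolding silov_boundary_def using is_boundary_evaluation_closure by blast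
  show "evaluation_closure ?A - {zero_functional ?A} \<subseteq> silov_boundary ?A"
    unfolding silov_boundary_def
  proof (intro subsetI InterI)
    fix \<phi> B
    assume \<phi>: "\<phi> \<in> evaluation_closure ?A - {zero_functional ?A}" and "B \<in> {B. is_boundary ?A B}"
    then have B: "is_boundary ?A B" by simp
    \<comment> \<open>Over the zero space the only functional on \<open>?A\<close> is the zero one,
      which \<open>\<phi>\<close> is not.\<close>
    have nontriv: "\<exists>\<xi>::'h. \<xi> \<noteq> 0"
    proof (rule ccontr)
      assume "\<nexists>\<xi>::'h. \<xi> \<noteq> 0"
      then have A: "?A = {0}"
        using rep_algebra_trivial[OF assms(2)] by blast
      have dual: "\<phi> \<in> dual_space ?A"
        using \<phi> evaluation_closure_dual by auto
      have "\<phi> 0 = 0"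
        using evaluation_closure_norm_le[of 0 \<phi>] \<phi> A by simp
      with dual have "\<phi> = zero_functional ?A"
        by (intro extensionalityI[of _ ?A]) (auto simp: A dual_space_def zero_functional_def)
      with \<phi> show False by simp
    qed
    \<comment> \<open>\<open>B\<close> is closed only relative to the spectrum. The weak* closed
      \<open>C\<close> can absorb all limits of evaluations; being a character brings
      \<open>\<phi>\<close> back into \<open>B\<close>.\<close>
    obtain C where C: "closedin (weak_star ?A) C" "B = C \<inter> gelfand_spectrum ?A"
      using B by (auto simp: is_boundary_def closedin_subtopology)
    have "evaluation_closure ?A \<subseteq> C"
      using C evaluation_mem_boundary[OF assms(2) B nontriv] by (intro evaluation_closure_subset) auto
    then show "\<phi> \<in> B"
      using \<phi> nonzero_evaluation_closure_eq C(2) by auto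
  qed
qed

end
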